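(* (a) Let $\alpha\in(1/(n+1),1)$ and let $((X_1,Y_1),\dots,(X_{n+1},Y_{n+1}))\in(\mathbb{R}^k\times\mathbb{R}^\ell)^{n+1}$ be exchangeable pairs of random vectors. Then $\rho'_{n,\alpha}\ge0$ (whenever $t_nq'_{n,\alpha}<n$, i.e. whenever $\rho'_{n,\alpha}$ is used in the definition of $\mathcal F_\alpha^n$). In particular, $Z_0^n\in\mathcal F_\alpha^n$ and $\mathcal F_\alpha^n$ is never empty. (b) Let $\alpha\in(0,1)$. Assume that the vectors $V_i$, $i\ge1$, are i.i.d., that $V_1$ has a well-defined covariance matrix $\boldsymbol\Sigma$, that $\lambda>0$, and that the quantile function of $\|(\boldsymbol\Sigma+\lambda\mathbf I_p)^{-1/2}(V_1-\mathbb{E}[V_1])\|^2$ is continuous on a neighbourhood of $1-\alpha$. Then $$\mathbb{P}(\mathcal F_\alpha^n=\mathbb{R}^\ell)\xrightarrow[n\to\infty]{}0.$$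
   Context: $k,\ell\ge1$, $p=k+\ell$; $\lambda>0$ is a fixed ridge parameter; $\widehat f:\mathbb{R}^k\to\mathbb{R}^\ell$ is a fixed deterministic measurable predictor. $R_i=Y_i-\widehat f(X_i)$, $V_i=(X_i^\top\ R_i^\top)^\top\in\mathbb{R}^p$. $\overline X_n,\overline R_n,\overline V_n$ are the averages over $i=1,\dots,n$, and $X_{n+1}^{\mathrm c}=X_{n+1}-\overline X_n$. $\mathbf B_n$ is the $n\times p$ matrix with $i$-th row $(V_i-\overline V_n)^\top$, $\mathbf B_n^X$ its left $n\times k$ block, and $\widehat{\boldsymbol\Sigma}_{n,\lambda}=\frac1n\mathbf B_n^\top\mathbf B_n+\lambda\mathbf I_p$ with blocks $\widehat{\boldsymbol\Sigma}_{n,\lambda}^{11},\widehat{\boldsymbol\Sigma}_n^{12},\widehat{\boldsymbol\Sigma}_n^{21},\widehat{\boldsymbol\Sigma}_{n,\lambda}^{22}$ according to $p=k+\ell$. $\boldsymbol{\mathcal A}_n=\widehat{\boldsymbol\Sigma}_{n,\lambda}^{22}-\widehat{\boldsymbol\Sigma}_n^{21}(\widehat{\boldsymbol\Sigma}_{n,\lambda}^{11})^{-1}\widehat{\boldsymbol\Sigma}_n^{12}$, $Z_0^n=\widehat{\boldsymbol\Sigma}_n^{21}(\widehat{\boldsymbol\Sigma}_{n,\lambda}^{11})^{-1}X_{n+1}^{\mathrm c}+\overline R_n$. $\mathbf P_{n,\lambda}=\mathbf B_n(\mathbf B_n^\top\mathbf B_n+n\lambda\mathbf I_p)^{-1}\mathbf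 B_n^\top$, $\mathbf P_{n,\lambda}^{XX}=\mathbf B_n^X((\mathbf B_n^X)^\top\mathbf B_n^X+n\lambda\mathbf I_k)^{-1}(\mathbf B_n^X)^\top$. $d_n^X=\frac1{n+1}(X_{n+1}^{\mathrm c})^\top(\widehat{\boldsymbol\Sigma}_{n,\lambda}^{11})^{-1}X_{n+1}^{\mathrm c}$. With $v=\frac1{n+1}(-1,\dots,-1,n)^\top\in\mathbb{R}^{n+1}$ ($\|v\|^2=n/(n+1)$) and $w=v/\|v\|$, $b_X^n=\frac{\|v\|}{n}\begin{pmatrix}\mathbf B_n^X(\widehat{\boldsymbol\Sigma}_{n,\lambda}^{11})^{-1}X_{n+1}^{\mathrm c}\\0\end{pmatrix}-w$. For $1\le i\le n$, $p'_{i,n}=(\mathbf P_{n,\lambda}-\mathbf P_{n,\lambda}^{XX})_{ii}+\frac{(b_X^n)_i^2}{1+d_n^X}$; $n_\alpha=\lceil(1-\alpha)(n+1)\rceil$; $q'_{n,\alpha}$ is $n$ times the $n_\alpha$-th smallest of $(p'_{1,n},\dots,p'_{n,n})$. $t_n=\frac{n+1}{n}(1+d_n^X)$. $\mathcal F_\alpha^n=\mathbb{R}^\ell$ if $t_nq'_{n,\alpha}\ge n$; otherwise $\mathcal F_\alpha^n=\{z\in\mathbb{R}^\ell:(z-Z_0^n)^\top\boldsymbol{\mathcal A}_n^{-1}(z-Z_0^n)\le\rho'_{n,\alpha}\}$ with $\rho'_{n,\alpha}=t_n^2\frac{q'_{n,\alpha}}{1-t_nq'_{n,\alpha}/n}$.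 *)

theory Defs
  imports "HOL-Probability.Probability"
begin

text \<open>
  Vectors of length \<open>p = k + l\<close> are indexed by the sum type \<open>'k + 'l\<close>. A sample is a sequence
  \<open>V :: nat \<Rightarrow> real^('k + 'l)\<close> used from index \<open>1\<close> on, whose \<open>i\<close>-th vector stacks \<open>X\<^sub>i\<close> and
  \<open>R\<^sub>i\<close>. As \<open>n\<close> varies, a matrix with \<open>n\<close> rows is given by its sequence of rows
  \<open>C :: nat \<Rightarrow> real^'c\<close>, of which the rows \<open>1, \<dots>, n\<close> count, and vectors of length \<open>n\<close> or
  \<open>n + 1\<close> are functions of an index starting at \<open>1\<close>.
\<close>

definition stack :: "real^'k \<Rightarrow> real^'l \<Rightarrow> real^('k::finite + 'l::finite)" where
  "stack x r = (\<chi> s. case s of Inl a \<Rightarrow> x $ a | Inr b \<Rightarrow> r $ b)"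

definition left_part :: "real^('k::finite + 'l::finite) \<Rightarrow> real^'k" where
  "left_part u = (\<chi> a. u $ Inl a)"

definition right_part :: "real^('k::finite + 'l::finite) \<Rightarrow> real^'l" where
  "right_part u = (\<chi> b. u $ Inr b)"

definition block11 :: "real^('k::finite + 'l::finite)^('k::finite + 'l::finite) \<Rightarrow> real^'k^'k" where
  "block11 S = (\<chi> a b. S $ Inl a $ Inl b)"

definition block12 :: "real^('k::finite + 'l::finite)^('k::finite + 'l::finite) \<Rightarrow> real^'l^'k" where
  "block12 S = (\<chi> a b. S $ Inl a $ Inr b)"

definition block21 :: "real^('k::finite + 'l::finite)^('k::finite + 'l::finite) \<Rightarrow> real^'k^'l" where
  "block21 S = (\<chi> a b. S $ Inr a $ Inl b)"

definition block22 :: "real^('k::finite + 'l::finite)^('k::finite + 'l::finite) \<Rightarrow> real^'l^'l" where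
  "block22 S = (\<chi> a b. S $ Inr a $ Inr b)"

definition sample_mean :: "nat \<Rightarrow> (nat \<Rightarrow> real^'c) \<Rightarrow> real^'c" where
  "sample_mean n u = (1 / real n) *\<^sub>R (\<Sum>i=1..n. u i)"

text \<open>\<open>C\<^sup>T C\<close> for the matrix \<open>C\<close> with rows \<open>C 1, \<dots>, C n\<close>.\<close>

definition gram :: "nat \<Rightarrow> (nat \<Rightarrow> real^'c) \<Rightarrow> real^'c^'c" where
  "gram n C = (\<chi> s t. \<Sum>i=1..n. C i $ s * C i $ t)"

text \<open>The \<open>(i, j)\<close> entry of \<open>C (C\<^sup>T C + n \<lambda> I)\<^sup>-\<^sup>1 C\<^sup>T\<close>.\<close>

definition ridge_hat :: "real \<Rightarrow> nat \<Rightarrow> (nat \<Rightarrow> real^'c) \<Rightarrow> nat \<Rightarrow> nat \<Rightarrow> real" where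
  "ridge_hat lam n C i j =
     C i \<bullet> (matrix_inv (gram n C + (real n * lam) *\<^sub>R mat 1) *v C j)"

definition Bmat :: "(nat \<Rightarrow> real^('k::finite + 'l::finite)) \<Rightarrow> nat \<Rightarrow> nat \<Rightarrow> real^('k::finite + 'l::finite)" where
  "Bmat V n i = V i - sample_mean n V"

definition BmatX :: "(nat \<Rightarrow> real^('k::finite + 'l::finite)) \<Rightarrow> nat \<Rightarrow> nat \<Rightarrow> real^'k" where
  "BmatX V n i = left_part (Bmat V n i)"

definition Sigma_hat :: "real \<Rightarrow> (nat \<Rightarrow> real^('k::finite + 'l::finite)) \<Rightarrow> nat \<Rightarrow> real^('k::finite + 'l::finite)^('k::finite + 'l::finite)" where
  "Sigma_hat lam V n = (1 / real n) *\<^sub>R gram n (Bmat V n) + lam *\<^sub>R mat 1"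

definition A_mat :: "real \<Rightarrow> (nat \<Rightarrow> real^('k::finite + 'l::finite)) \<Rightarrow> nat \<Rightarrow> real^'l^'l" where
  "A_mat lam V n = (let S = Sigma_hat lam V n in
     block22 S - block21 S ** matrix_inv (block11 S) ** block12 S)"

definition Xc :: "(nat \<Rightarrow> real^('k::finite + 'l::finite)) \<Rightarrow> nat \<Rightarrow> real^'k" where
  "Xc V n = left_part (V (n + 1)) - sample_mean n (\<lambda>i. left_part (V i))"

definition Z0 :: "real \<Rightarrow> (nat \<Rightarrow> real^('k::finite + 'l::finite)) \<Rightarrow> nat \<Rightarrow> real^'l" where
  "Z0 lam V n = (let S = Sigma_hat lam V n in
     (block21 S ** matrix_inv (block11 S)) *v Xc V n + sample_mean n (\<lambda>i. right_part (V i)))"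

definition dX :: "real \<Rightarrow> (nat \<Rightarrow> real^('k::finite + 'l::finite)) \<Rightarrow> nat \<Rightarrow> real" where
  "dX lam V n = 1 / (real n + 1) *
     (Xc V n \<bullet> (matrix_inv (block11 (Sigma_hat lam V n)) *v Xc V n))"

definition v_vec :: "nat \<Rightarrow> nat \<Rightarrow> real" where
  "v_vec n i = 1 / (real n + 1) * (if i = n + 1 then real n else - 1)"

definition v_norm :: "nat \<Rightarrow> real" where
  "v_norm n = sqrt (\<Sum>i=1..n+1. (v_vec n i)\<^sup>2)"

definition w_vec :: "nat \<Rightarrow> nat \<Rightarrow> real" where
  "w_vec n i = v_vec n i / v_norm n"

definition bX :: "real \<Rightarrow> (nat \<Rightarrow> real^('k::finite + 'l::finite)) \<Rightarrow> nat \<Rightarrow> nat \<Rightarrow> real" where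
  "bX lam V n i =
     v_norm n / real n *
       (if i \<le> n
        then BmatX V n i \<bullet> (matrix_inv (block11 (Sigma_hat lam V n)) *v Xc V n)
        else 0)
     - w_vec n i"

definition p_score :: "real \<Rightarrow> (nat \<Rightarrow> real^('k::finite + 'l::finite)) \<Rightarrow> nat \<Rightarrow> nat \<Rightarrow> real" where
  "p_score lam V n i =
     (ridge_hat lam n (Bmat V n) i i - ridge_hat lam n (BmatX V n) i i)
     + (bX lam V n i)\<^sup>2 / (1 + dX lam V n)"

definition n_alpha :: "real \<Rightarrow> nat \<Rightarrow> nat" where
  "n_alpha \<alpha> n = nat \<lceil>(1 - \<alpha>) * (real n + 1)\<rceil>"

text \<open>
  The order statistic is meaningful for \<open>1 \<le> n_alpha \<alpha> n \<le> n\<close>, that is, for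
  \<open>1 / (n + 1) \<le> \<alpha> < 1\<close>. If \<open>0 < \<alpha> < 1\<close>, this fails for only finitely many \<open>n\<close>.
\<close>

definition q_quant :: "real \<Rightarrow> (nat \<Rightarrow> real^('k::finite + 'l::finite)) \<Rightarrow> nat \<Rightarrow> real \<Rightarrow> real" where
  "q_quant lam V n \<alpha> =
     real n * (sort (map (p_score lam V n) [1..<n+1]) ! (n_alpha \<alpha> n - 1))"

definition t_fac :: "real \<Rightarrow> (nat \<Rightarrow> real^('k::finite + 'l::finite)) \<Rightarrow> nat \<Rightarrow> real" where
  "t_fac lam V n = (real n + 1) / real n * (1 + dX lam V n)"

definition rho :: "real \<Rightarrow> (nat \<Rightarrow> real^('k::finite + 'l::finite)) \<Rightarrow> nat \<Rightarrow> real \<Rightarrow> real" where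
  "rho lam V n \<alpha> = (t_fac lam V n)\<^sup>2 *
     (q_quant lam V n \<alpha> / (1 - t_fac lam V n * q_quant lam V n \<alpha> / real n))"

definition F_set :: "real \<Rightarrow> (nat \<Rightarrow> real^('k::finite + 'l::finite)) \<Rightarrow> nat \<Rightarrow> real \<Rightarrow> (real^'l) set" where
  "F_set lam V n \<alpha> =
     (if t_fac lam V n * q_quant lam V n \<alpha> \<ge> real n then UNIV
      else {z. (z - Z0 lam V n) \<bullet> (matrix_inv (A_mat lam V n) *v (z - Z0 lam V n))
                 \<le> rho lam V n \<alpha>})"

definition exchangeable ::
    "'a measure \<Rightarrow> 'b measure \<Rightarrow> 'i set \<Rightarrow> ('i \<Rightarrow> 'a \<Rightarrow> 'b) \<Rightarrow> bool" where
  "exchangeable M N I Z \<longleftrightarrow>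
     (\<forall>\<pi>. \<pi> permutes I \<longrightarrow>
        distr M (PiM I (\<lambda>_. N)) (\<lambda>\<omega>. \<lambda>i\<in>I. Z (\<pi> i) \<omega>)
        = distr M (PiM I (\<lambda>_. N)) (\<lambda>\<omega>. \<lambda>i\<in>I. Z i \<omega>))"

definition covariance_matrix :: "'a measure \<Rightarrow> ('a \<Rightarrow> real^'c) \<Rightarrow> real^'c^'c" where
  "covariance_matrix M W =
     (\<chi> s t. LINT \<omega>|M. (W \<omega> - (LINT \<xi>|M. W \<xi>)) $ s * (W \<omega> - (LINT \<xi>|M. W \<xi>)) $ t)"

text \<open>
  The symmetric positive semidefinite square root; it exists and is unique for symmetric
  positive semidefinite \<open>A\<close>, and it is unspecified for other \<open>A\<close>.
\<close>

definition psd_sqrt :: "real^'c^'c \<Rightarrow> real^'c^'c" where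
  "psd_sqrt A = (SOME S. transpose S = S \<and> (\<forall>x. 0 \<le> x \<bullet> (S *v x)) \<and> S ** S = A)"

text \<open>
  The generalized inverse of the distribution function of \<open>W\<close>. Only the levels
  \<open>0 < u < 1\<close> are meaningful.
\<close>

definition quantile_fun :: "'a measure \<Rightarrow> ('a \<Rightarrow> real) \<Rightarrow> real \<Rightarrow> real" where
  "quantile_fun M W u = Inf {x. u \<le> cdf (distr M borel W) x}"

end

theory Submission
  imports Defs
begin

text \<open>
  Part (a) is a statement about one fixed sample. The ridge hat matrix of a block of columns is
  dominated on the diagonal by that of all columns (\<open>ridge_hat_left_le\<close>), so all scores, and hence
  \<open>q_quant\<close>, are nonnegative. When the prediction set is an ellipsoid, its squared radius \<open>rho\<close> is
  then nonnegative too, and the ellipsoid contains its centre.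

  For part (b), the Schur complement \<open>A_mat\<close> is positive definite, so the ellipsoid is never the
  whole space, and the event in question is exactly \<open>n \<le> t_fac * q_quant\<close>. The left side grows, while
  the right side stays bounded in probability. Indeed, let \<open>s\<close> be the sum of
  \<open>\<parallel>V\<^sub>1\<parallel>\<^sup>2, \<dots>, \<parallel>V\<^sub>n\<^sub>+\<^sub>1\<parallel>\<^sup>2\<close> divided by \<open>n\<close>. Ridge regularization bounds every inverse that occurs,
  so the sum of all scores is at most quadratic in \<open>s\<close>, and \<open>t_fac\<close> is at most linear in \<open>s\<close>. About
  \<open>\<alpha> n\<close> of the scores are at least as large as the order statistic \<open>q_quant / n\<close>; since the scores
  are nonnegative, \<open>q_quant\<close> is at most a constant times their sum (\<open>q_quant_le_sum\<close>). Altogether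
  \<open>t_fac * q_quant\<close> is at most a fixed increasing function of \<open>s\<close>, uniformly in \<open>n\<close>
  (\<open>t_fac_q_quant_le\<close>). The expectation of \<open>s\<close> is bounded in \<open>n\<close>, so Markov's inequality makes the
  probability that \<open>s\<close> exceeds a large constant uniformly small (\<open>prob_mean_square_ge_le\<close>).
\<close>

section \<open>Coercive matrices matrices\<close>

text \<open>
  The constant is kept explicit because the ridge parameter is a lower bound for the empirical
  covariance that holds for all samples and sample sizes at once.
\<close>

definition coercive :: "real \<Rightarrow> real^'c^'c \<Rightarrow> bool" where
  "coercive c S \<longleftrightarrow> (\<forall>x. c * (norm x)\<^sup>2 \<le> x \<bullet> (S *v x))"

lemma coerciveD: "coercive c S \<Longrightarrow> c * (norm x)\<^sup>2 \<le> x \<bullet> (S *v x)"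
  by (simp add: coercive_def)

lemma coercive_invertible:
  fixes S :: "real^'c^'c"
  assumes "coercive c S" "c > 0"
  shows "invertible S"
proof -
  have "x = 0" if "S *v x = 0" for x
    using coerciveD[OF assms(1), of x] assms(2) that by (simp add: mult_le_0_iff)
  then have "\<exists>B. B ** S = mat 1"
    using matrix_left_invertible_ker by blast
  then show ?thesis
    using invertible_left_inverse by blast
qed

lemma coercive_mult_inv:
  fixes S :: "real^'c^'c"
  assumes "coercive c S" "c > 0"
  shows "S *v (matrix_inv S *v u) = u"
proof -
  have "S ** matrix_inv S = mat 1"
    using coercive_invertible[OF assms] unfolding invertible_def matrix_inv_def
    by (metis (mono_tags, lifting) someI_ex)
  then show ?thesis
    by (simp add: matrix_vector_mul_assoc)
qed

lemma coercive_inv_quadratic: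
  fixes S :: "real^'c^'c"
  assumes "coercive c S" "c > 0"
  shows "c * (norm (matrix_inv S *v u))\<^sup>2 \<le> u \<bullet> (matrix_inv S *v u)"
  using coerciveD[OF assms(1), of "matrix_inv S *v u"]
  by (simp add: coercive_mult_inv[OF assms] inner_commute)

lemma coercive_inv_nonneg:
  fixes S :: "real^'c^'c"
  assumes "coercive c S" "c > 0"
  shows "0 \<le> u \<bullet> (matrix_inv S *v u)"
  by (rule order_trans[OF _ coercive_inv_quadratic[OF assms]]) (use assms in simp)

lemma coercive_inv_pos:
  fixes S :: "real^'c^'c"
  assumes "coercive c S" "c > 0" "u \<noteq> 0"
  shows "0 < u \<bullet> (matrix_inv S *v u)"
proof -
  have "matrix_inv S *v u \<noteq> 0"
    using coercive_mult_inv[OF assms(1,2), of u] assms(3) by auto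
  then have "0 < c * (norm (matrix_inv S *v u))\<^sup>2"
    using assms(2) by simp
  then show ?thesis
    using coercive_inv_quadratic[OF assms(1,2), of u] by linarith
qed

lemma coercive_inv_norm_le:
  fixes S :: "real^'c^'c"
  assumes "coercive c S" "c > 0"
  shows "norm (matrix_inv S *v u) \<le> norm u / c"
proof (cases "matrix_inv S *v u = 0")
  case False
  let ?y = "matrix_inv S *v u"
  have "c * (norm ?y)\<^sup>2 \<le> norm u * norm ?y"
    using coercive_inv_quadratic[OF assms, of u] norm_cauchy_schwarz[of u ?y] by linarith
  then have "c * norm ?y \<le> norm u"
    using False by (simp add: power2_eq_square mult.assoc[symmetric])
  then show ?thesis
    using assms(2) by (simp add: field_simps)
qed (use assms in simp)

lemma coercive_inv_bilinear_le:
  fixes S :: "real^'c^'c"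
  assumes "coercive c S" "c > 0"
  shows "\<bar>w \<bullet> (matrix_inv S *v u)\<bar> \<le> norm w * norm u / c"
proof -
  have "\<bar>w \<bullet> (matrix_inv S *v u)\<bar> \<le> norm w * norm (matrix_inv S *v u)"
    by (rule Cauchy_Schwarz_ineq2)
  also have "\<dots> \<le> norm w * (norm u / c)"
    by (intro mult_left_mono coercive_inv_norm_le assms) simp
  finally show ?thesis by simp
qed

text \<open>
  The variational description of an inverse quadratic form: the gap between the two sides is the
  quadratic form of \<open>S\<close> at \<open>x - S\<^sup>-\<^sup>1 u\<close>. It turns comparisons of inverses into restrictions of \<open>x\<close>.
\<close>

lemma coercive_inv_quadratic_ge:
  fixes S :: "real^'c^'c"
  assumes "coercive c S" "c > 0" "transpose S = S"
  shows "2 * (u \<bullet> x) - x \<bullet> (S *v x) \<le> u \<bullet> (matrix_inv S *v u)"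
proof -
  let ?y = "matrix_inv S *v u"
  have "0 \<le> (x - ?y) \<bullet> (S *v (x - ?y))"
    by (rule order_trans[OF _ coerciveD[OF assms(1)]]) (use assms in simp)
  also have "\<dots> = x \<bullet> (S *v x) - x \<bullet> u - ?y \<bullet> (S *v x) + ?y \<bullet> u"
    by (simp add: matrix_vector_mult_diff_distrib coercive_mult_inv[OF assms(1,2)] inner_diff_left
        inner_diff_right)
  also have "?y \<bullet> (S *v x) = u \<bullet> x"
    using dot_lmul_matrix[of ?y S x] transpose_matrix_vector[of S ?y] assms(3)
    by (simp add: coercive_mult_inv[OF assms(1,2)])
  finally show ?thesis
    by (simp add: inner_commute)
qed

section \<open>Block matrices\<close>

lemma sum_UNIV_Plus:
  fixes g :: "('k::finite + 'l::finite) \<Rightarrow> real"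
  shows "sum g UNIV = (\<Sum>a\<in>UNIV. g (Inl a)) + (\<Sum>b\<in>UNIV. g (Inr b))"
  by (simp add: UNIV_Plus_UNIV[symmetric] sum.Plus del: UNIV_Plus_UNIV)

lemma inner_left_right: "u \<bullet> w = left_part u \<bullet> left_part w + right_part u \<bullet> right_part w"
  by (simp add: inner_vec_def left_part_def right_part_def sum_UNIV_Plus)

lemma norm_left_part_le: "norm (left_part u) \<le> norm u"
  by (simp add: norm_eq_sqrt_inner inner_left_right[of u u])

lemma left_part_stack [simp]: "left_part (stack x r) = x"
  by (simp add: left_part_def stack_def vec_eq_iff)

lemma right_part_stack [simp]: "right_part (stack x r) = r"
  by (simp add: right_part_def stack_def vec_eq_iff)

lemma left_part_mult: "left_part (S *v u) = block11 S *v left_part u + block12 S *v right_part u"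
  by (simp add: vec_eq_iff left_part_def right_part_def block11_def block12_def
      matrix_vector_mult_def sum_UNIV_Plus)

lemma right_part_mult: "right_part (S *v u) = block21 S *v left_part u + block22 S *v right_part u"
  by (simp add: vec_eq_iff left_part_def right_part_def block21_def block22_def
      matrix_vector_mult_def sum_UNIV_Plus)

lemma inner_stack_left: "stack x 0 \<bullet> (S *v stack x 0) = x \<bullet> (block11 S *v x)"
  by (simp add: inner_left_right left_part_mult)

lemma coercive_block11:
  assumes "coercive c S"
  shows "coercive c (block11 S)"
  unfolding coercive_def
proof
  fix x
  show "c * (norm x)\<^sup>2 \<le> x \<bullet> (block11 S *v x)"
    using coerciveD[OF assms, of "stack x 0"]
    by (simp add: inner_stack_left power2_norm_eq_inner) (simp add: inner_left_right)
qed

text \<open>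
  In the variational description, the left-hand side is the supremum over the vectors whose right
  part vanishes, and the right-hand side is the supremum over all vectors.
\<close>

lemma block11_inv_quadratic_le:
  assumes "coercive c S" "c > 0" "transpose S = S"
  shows "left_part u \<bullet> (matrix_inv (block11 S) *v left_part u) \<le> u \<bullet> (matrix_inv S *v u)"
proof -
  let ?y = "matrix_inv (block11 S) *v left_part u"
  have "block11 S *v ?y = left_part u"
    by (rule coercive_mult_inv[OF coercive_block11]) (use assms in auto)
  then have "2 * (u \<bullet> stack ?y 0) - stack ?y 0 \<bullet> (S *v stack ?y 0) = left_part u \<bullet> ?y"
    unfolding inner_stack_left by (simp add: inner_left_right inner_commute)
  then show ?thesis
    using coercive_inv_quadratic_ge[OF assms, of u "stack ?y 0"] by simp
qed

text \<open>
  The Schur complement at \<open>x\<close> is the quadratic form of \<open>S\<close> at the vector with right part \<open>x\<close> and with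
  the left part that makes the left part of the image zero.
\<close>

lemma coercive_Schur_complement:
  assumes "coercive c S" "c > 0"
  shows "coercive c (block22 S - block21 S ** matrix_inv (block11 S) ** block12 S)"
  unfolding coercive_def
proof
  fix x
  let ?A = "block22 S - block21 S ** matrix_inv (block11 S) ** block12 S"
  let ?y = "- (matrix_inv (block11 S) *v (block12 S *v x))"
  have "block11 S *v ?y = - (block12 S *v x)"
    using coercive_mult_inv[OF coercive_block11[OF assms(1)] assms(2)]
    by (simp add: linear_neg[OF matrix_vector_mul_linear])
  then have "left_part (S *v stack ?y x) = 0"
    by (simp add: left_part_mult)
  moreover have "right_part (S *v stack ?y x) = ?A *v x"
    by (simp add: right_part_mult linear_neg[OF matrix_vector_mul_linear]
        matrix_vector_mult_diff_rdistrib matrix_vector_mul_assoc matrix_mul_assoc)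
  ultimately have "stack ?y x \<bullet> (S *v stack ?y x) = x \<bullet> (?A *v x)"
    by (simp add: inner_left_right)
  moreover have "(norm x)\<^sup>2 \<le> (norm (stack ?y x))\<^sup>2"
    by (simp add: power2_norm_eq_inner inner_left_right[of "stack ?y x"])
  ultimately show "c * (norm x)\<^sup>2 \<le> x \<bullet> (?A *v x)"
    using coerciveD[OF assms(1), of "stack ?y x"] assms(2)
      mult_left_mono[of "(norm x)\<^sup>2" "(norm (stack ?y x))\<^sup>2" c] by linarith
qed

section \<open>Regularized Gram matrices\<close>

lemma gram_mult: "gram n C *v x = (\<Sum>i=1..n. (C i \<bullet> x) *\<^sub>R C i)"
  by (simp add: vec_eq_iff gram_def matrix_vector_mult_def inner_vec_def sum_distrib_right
      sum_distrib_left sum.swap[of _ _ UNIV] mult_ac)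

lemma scaleR_mat_mult: "(c *\<^sub>R mat 1) *v x = c *\<^sub>R (x :: real^'c)"
  by (simp add: scaleR_matrix_vector_assoc[symmetric])

lemma coercive_gram: "coercive r (gram n C + r *\<^sub>R mat 1)"
  unfolding coercive_def
proof
  fix x
  have "x \<bullet> (gram n C *v x) = (\<Sum>i=1..n. (C i \<bullet> x)\<^sup>2)"
    by (simp add: gram_mult inner_sum_right power2_eq_square inner_commute)
  also have "\<dots> \<ge> 0"
    by (intro sum_nonneg) simp
  finally show "r * (norm x)\<^sup>2 \<le> x \<bullet> ((gram n C + r *\<^sub>R mat 1) *v x)"
    by (simp add: matrix_vector_mult_add_rdistrib scaleR_mat_mult inner_add_right
        power2_norm_eq_inner)
qed

lemma transpose_gram: "transpose (gram n C + r *\<^sub>R mat 1) = gram n C + r *\<^sub>R mat 1"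
  by (auto simp: vec_eq_iff transpose_def gram_def mat_def mult.commute intro: sum.cong)

lemma block11_gram:
  "block11 (gram n C + r *\<^sub>R mat 1) = gram n (\<lambda>i. left_part (C i)) + r *\<^sub>R mat 1"
  by (simp add: vec_eq_iff block11_def gram_def mat_def left_part_def)

text \<open>
  The Gram matrix of the left columns is a diagonal block of the full Gram matrix, so this is the
  comparison of inverse quadratic forms for blocks.
\<close>

lemma ridge_hat_left_le:
  assumes "n \<ge> 1" "lam > 0"
  shows "ridge_hat lam n (\<lambda>i. left_part (C i)) i i \<le> ridge_hat lam n C i i"
  unfolding ridge_hat_def block11_gram[symmetric]
  by (rule block11_inv_quadratic_le[OF coercive_gram _ transpose_gram]) (use assms in simp)

lemma ridge_hat_nonneg:
  assumes "n \<ge> 1" "lam > 0"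
  shows "0 \<le> ridge_hat lam n C i i"
  unfolding ridge_hat_def by (rule coercive_inv_nonneg[OF coercive_gram]) (use assms in simp)

lemma ridge_hat_le:
  assumes "n \<ge> 1" "lam > 0"
  shows "ridge_hat lam n C i i \<le> (norm (C i))\<^sup>2 / (real n * lam)"
  using coercive_inv_bilinear_le[OF coercive_gram[of "real n * lam" n C], of "C i" "C i"] assms
  by (simp add: ridge_hat_def power2_eq_square)

lemma coercive_Sigma_hat:
  assumes "n \<ge> 1"
  shows "coercive lam (Sigma_hat lam V n)"
  unfolding coercive_def
proof
  fix x
  have "0 \<le> x \<bullet> (gram n (Bmat V n) *v x)"
    using coerciveD[OF coercive_gram[of 0 n "Bmat V n"], of x] by simp
  then show "lam * (norm x)\<^sup>2 \<le> x \<bullet> (Sigma_hat lam V n *v x)"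
    using assms
    by (simp add: Sigma_hat_def matrix_vector_mult_add_rdistrib scaleR_mat_mult inner_add_right
        power2_norm_eq_inner scaleR_matrix_vector_assoc[symmetric])
qed

section \<open>The scores and their order statistics\<close>

lemma dX_nonneg:
  assumes "n \<ge> 1" "lam > 0"
  shows "0 \<le> dX lam V n"
  unfolding dX_def
  by (intro mult_nonneg_nonneg
      coercive_inv_nonneg[OF coercive_block11[OF coercive_Sigma_hat[OF assms(1)]] assms(2)]) simp

lemma p_score_nonneg:
  assumes "n \<ge> 1" "lam > 0"
  shows "0 \<le> p_score lam V n i"
  using ridge_hat_left_le[OF assms, of "Bmat V n" i] dX_nonneg[OF assms, of V]
  by (simp add: p_score_def BmatX_def[abs_def])

lemma n_alpha_ge_1:
  assumes "\<alpha> < 1"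
  shows "1 \<le> n_alpha \<alpha> n"
proof -
  have "0 < (1 - \<alpha>) * (real n + 1)"
    using assms by (intro mult_pos_pos) auto
  then show ?thesis
    by (simp add: n_alpha_def Suc_le_eq)
qed

lemma n_alpha_lt:
  assumes "\<alpha> < 1"
  shows "real (n_alpha \<alpha> n) < (1 - \<alpha>) * (real n + 1) + 1"
proof -
  have "0 < (1 - \<alpha>) * (real n + 1)"
    using assms by (intro mult_pos_pos) auto
  then show ?thesis
    unfolding n_alpha_def by linarith
qed

lemma n_alpha_le:
  assumes "1 / (real n + 1) < \<alpha>" "\<alpha> < 1"
  shows "n_alpha \<alpha> n \<le> n"
proof -
  have "1 < \<alpha> * (real n + 1)"
    using assms(1) by (simp add: field_simps)
  then have "real (n_alpha \<alpha> n) < real n + 1"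
    using n_alpha_lt[OF assms(2), of n] by (simp add: algebra_simps)
  then show ?thesis by linarith
qed

lemma q_quant_nonneg:
  assumes "1 / (real n + 1) < \<alpha>" "\<alpha> < 1" "n \<ge> 1" "lam > 0"
  shows "0 \<le> q_quant lam V n \<alpha>"
proof -
  let ?xs = "map (p_score lam V n) [1..<n+1]"
  have "sort ?xs ! (n_alpha \<alpha> n - 1) \<in> set (sort ?xs)"
    by (rule nth_mem)
      (use n_alpha_le[OF assms(1,2)] n_alpha_ge_1[OF assms(2), of n] in simp)
  then show ?thesis
    using p_score_nonneg[OF assms(3,4), of V] by (auto simp: q_quant_def)
qed

lemma rho_nonneg:
  assumes "0 \<le> q_quant lam V n \<alpha>" "t_fac lam V n * q_quant lam V n \<alpha> < real n"
  shows "0 \<le> rho lam V n \<alpha>"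
  using assms unfolding rho_def
  by (intro mult_nonneg_nonneg divide_nonneg_nonneg) (auto simp: divide_le_eq_1)

text \<open>
  A Markov inequality for order statistics: the entries from position \<open>j\<close> on are all at least as
  large as the one at position \<open>j\<close>, and the entries before it contribute nonnegatively.
\<close>

lemma sort_nth_mult_le_sum_list:
  fixes xs :: "real list"
  assumes "j < length xs" "\<And>x. x \<in> set xs \<Longrightarrow> 0 \<le> x"
  shows "real (length xs - j) * (sort xs ! j) \<le> sum_list xs"
proof -
  let ?s = "sort xs"
  have "real (length xs - j) * (?s ! j) = sum_list (map (\<lambda>_. ?s ! j) (drop j ?s))"
    by (simp add: sum_list_triv)
  also have "\<dots> \<le> sum_list (map (\<lambda>x. x) (drop j ?s))"
    by (rule sum_list_mono) (use assms(1) in \<open>auto simp: in_set_conv_nth intro!: sorted_nth_mono\<close>)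
  also have "\<dots> \<le> sum_list (take j ?s) + sum_list (drop j ?s)"
    using assms(2) by (auto intro!: sum_list_nonneg dest: in_set_takeD)
  also have "\<dots> = sum_list ?s"
    by (metis append_take_drop_id sum_list_append)
  also have "\<dots> = sum_list xs"
    by (metis mset_sort sum_mset_sum_list)
  finally show ?thesis .
qed

text \<open>
  The condition on \<open>n\<close> makes the order statistic meaningful and leaves at least \<open>\<alpha> n / 2\<close> scores at or
  above it.
\<close>

lemma q_quant_le_sum:
  assumes "\<alpha> > 0" "\<alpha> < 1" "real n \<ge> 2 / \<alpha>" "lam > 0"
  shows "q_quant lam V n \<alpha> \<le> 2 / \<alpha> * (\<Sum>i=1..n. p_score lam V n i)"
proof -
  let ?xs = "map (p_score lam V n) [1..<n+1]"
  let ?m = "n_alpha \<alpha> n"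
  let ?v = "sort ?xs ! (?m - 1)"
  have an: "2 \<le> \<alpha> * real n"
    using assms by (simp add: field_simps)
  then have n1: "n \<ge> 1"
    by (cases n) auto
  have "1 / (real n + 1) < \<alpha>"
    using an assms(1) by (simp add: field_simps)
  note m = n_alpha_le[OF this assms(2)] n_alpha_ge_1[OF assms(2), of n]
  have pos: "0 \<le> x" if "x \<in> set ?xs" for x
    using that p_score_nonneg[OF n1 assms(4), of V] by auto
  have "?v \<in> set (sort ?xs)"
    by (rule nth_mem) (use m in simp)
  then have v: "0 \<le> ?v"
    using pos by simp
  have "\<alpha> * real n / 2 \<le> real (length ?xs - (?m - 1))"
    using an n_alpha_lt[OF assms(2), of n] m assms by (simp add: of_nat_diff algebra_simps)
  then have "\<alpha> * real n / 2 * ?v \<le> real (length ?xs - (?m - 1)) * ?v"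
    using v by (rule mult_right_mono)
  also have "\<dots> \<le> sum_list ?xs"
    by (rule sort_nth_mult_le_sum_list) (use m pos in auto)
  also have "sum_list ?xs = (\<Sum>i=1..n. p_score lam V n i)"
    by (simp add: interv_sum_list_conv_sum_set_nat atLeastLessThanSuc_atLeastAtMost del: upt_Suc)
  finally show ?thesis
    using assms(1) by (simp add: q_quant_def field_simps)
qed

section \<open>Bounds by the empirical second moment\<close>

lemma sum_norm_centered:
  fixes u :: "nat \<Rightarrow> real^'c"
  assumes "n \<ge> 1"
  shows "(\<Sum>i=1..n. (norm (u i - sample_mean n u))\<^sup>2)
    = (\<Sum>i=1..n. (norm (u i))\<^sup>2) - real n * (norm (sample_mean n u))\<^sup>2"
proof -
  let ?m = "sample_mean n u"
  have s: "(\<Sum>i=1..n. u i) = real n *\<^sub>R ?m"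
    using assms by (simp add: sample_mean_def)
  have "(\<Sum>i=1..n. (norm (u i - ?m))\<^sup>2)
      = (\<Sum>i=1..n. (norm (u i))\<^sup>2) - 2 * ((\<Sum>i=1..n. u i) \<bullet> ?m) + real n * (?m \<bullet> ?m)"
    by (simp add: power2_norm_eq_inner inner_diff_left inner_diff_right inner_commute
        sum.distrib sum_subtractf inner_sum_right algebra_simps sum_distrib_left)
  then show ?thesis
    unfolding s by (simp add: power2_norm_eq_inner)
qed

lemma sample_mean_norm_le:
  fixes u :: "nat \<Rightarrow> real^'c"
  assumes "n \<ge> 1"
  shows "(norm (sample_mean n u))\<^sup>2 \<le> (\<Sum>i=1..n. (norm (u i))\<^sup>2)"
proof -
  have "0 \<le> (\<Sum>i=1..n. (norm (u i - sample_mean n u))\<^sup>2)"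
    by (intro sum_nonneg) simp
  moreover have "1 * (norm (sample_mean n u))\<^sup>2 \<le> real n * (norm (sample_mean n u))\<^sup>2"
    using assms by (intro mult_right_mono) auto
  ultimately show ?thesis
    using sum_norm_centered[OF assms, of u] by simp
qed

lemma Xc_eq: "Xc V n = left_part (V (n + 1) - sample_mean n V)"
  by (simp add: Xc_def left_part_def sample_mean_def vec_eq_iff)

lemma norm_Xc_le:
  assumes "n \<ge> 1"
  shows "(norm (Xc V n))\<^sup>2 \<le> 2 * (\<Sum>i=1..n+1. (norm (V i))\<^sup>2)"
proof -
  let ?m = "sample_mean n V"
  have "(norm (Xc V n))\<^sup>2 \<le> (norm (V (n + 1) - ?m))\<^sup>2"
    unfolding Xc_eq by (intro power_mono norm_left_part_le) simp
  also have "\<dots> \<le> (norm (V (n + 1)) + norm ?m)\<^sup>2"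
    by (intro power_mono norm_triangle_ineq4) simp
  also have "\<dots> \<le> 2 * (norm (V (n + 1)))\<^sup>2 + 2 * (norm ?m)\<^sup>2"
    using zero_le_power2[of "norm (V (n + 1)) - norm ?m"] by (simp add: power2_eq_square algebra_simps)
  also have "\<dots> \<le> 2 * (\<Sum>i=1..n+1. (norm (V i))\<^sup>2)"
    using sample_mean_norm_le[OF assms, of V] by simp
  finally show ?thesis .
qed

lemma v_norm_sq: "(v_norm n)\<^sup>2 = real n / (real n + 1)"
proof -
  have "(\<Sum>i=1..n+1. (v_vec n i)\<^sup>2) = (\<Sum>i=1..n. (v_vec n i)\<^sup>2) + (v_vec n (n+1))\<^sup>2"
    by simp
  also have "(\<Sum>i=1..n. (v_vec n i)\<^sup>2) = (\<Sum>i=1..n. 1 / (real n + 1)\<^sup>2)"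
    by (intro sum.cong) (auto simp: v_vec_def power_divide)
  also have "\<dots> + (v_vec n (n+1))\<^sup>2 = (real n + (real n)\<^sup>2) / (real n + 1)\<^sup>2"
    by (simp add: v_vec_def power_divide add_divide_distrib)
  also have "\<dots> = real n * (real n + 1) / ((real n + 1) * (real n + 1))"
    by (simp add: power2_eq_square algebra_simps)
  also have "\<dots> = real n / (real n + 1)"
    by (subst mult_divide_mult_cancel_right) auto
  finally have "(\<Sum>i=1..n+1. (v_vec n i)\<^sup>2) = real n / (real n + 1)" .
  then show ?thesis
    by (simp add: v_norm_def)
qed

lemma w_vec_sq:
  assumes "1 \<le> n" "i \<le> n"
  shows "(w_vec n i)\<^sup>2 = 1 / (real n * (real n + 1))"
proof -
  have "(v_vec n i)\<^sup>2 = 1 / ((real n + 1) * (real n + 1))"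
    using assms by (simp add: v_vec_def power_divide power2_eq_square)
  then show ?thesis
    using assms by (simp add: w_vec_def power_divide v_norm_sq)
qed

lemma bX_sq_le:
  assumes "1 \<le> n" "i \<le> n" "lam > 0"
  shows "(bX lam V n i)\<^sup>2
    \<le> 2 * ((norm (Bmat V n i))\<^sup>2 * (norm (Xc V n))\<^sup>2 / ((real n)\<^sup>2 * lam\<^sup>2)) + 2 / real n"
proof -
  let ?g = "BmatX V n i \<bullet> (matrix_inv (block11 (Sigma_hat lam V n)) *v Xc V n)"
  have "\<bar>?g\<bar> \<le> norm (BmatX V n i) * norm (Xc V n) / lam"
    by (rule coercive_inv_bilinear_le[OF coercive_block11[OF coercive_Sigma_hat]])
      (use assms in auto)
  also have "\<dots> \<le> norm (Bmat V n i) * norm (Xc V n) / lam"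
    unfolding BmatX_def
    by (intro divide_right_mono mult_right_mono norm_left_part_le) (use assms in auto)
  finally have "?g\<^sup>2 \<le> (norm (Bmat V n i) * norm (Xc V n) / lam)\<^sup>2"
    using abs_ge_zero power2_abs power_mono by metis
  then have g: "?g\<^sup>2 / (real n)\<^sup>2 \<le> (norm (Bmat V n i))\<^sup>2 * (norm (Xc V n))\<^sup>2 / ((real n)\<^sup>2 * lam\<^sup>2)"
    using divide_right_mono[of "?g\<^sup>2" _ "(real n)\<^sup>2"]
    by (fastforce simp: power_mult_distrib power_divide mult_ac)
  have "(v_norm n / real n * ?g)\<^sup>2 = real n / (real n + 1) * (?g\<^sup>2 / (real n)\<^sup>2)"
    by (simp only: power_mult_distrib power_divide v_norm_sq) simp
  also have "\<dots> \<le> 1 * (?g\<^sup>2 / (real n)\<^sup>2)"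
    by (intro mult_right_mono) auto
  finally have a: "(v_norm n / real n * ?g)\<^sup>2 \<le> ?g\<^sup>2 / (real n)\<^sup>2" by simp
  have "1 / (real n * (real n + 1)) \<le> 1 / real n"
    using assms by (intro divide_left_mono) (auto simp: mult_le_cancel_left1)
  then have w: "(w_vec n i)\<^sup>2 \<le> 1 / real n"
    using w_vec_sq[OF assms(1,2)] by simp
  have "(bX lam V n i)\<^sup>2 = (v_norm n / real n * ?g - w_vec n i)\<^sup>2"
    using assms by (simp add: bX_def)
  also have "\<dots> \<le> 2 * (v_norm n / real n * ?g)\<^sup>2 + 2 * (w_vec n i)\<^sup>2"
    using zero_le_power2[of "v_norm n / real n * ?g + w_vec n i"]
    unfolding power2_diff power2_sum by linarith
  finally show ?thesis
    using a w g by simp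
qed

text \<open>
  The sum has \<open>n + 1\<close> terms, to include the new observation, but it is divided by \<open>n\<close>, the
  normalization of the empirical covariance.
\<close>

definition mean_square :: "nat \<Rightarrow> (nat \<Rightarrow> real^'c) \<Rightarrow> real" where
  "mean_square n V = (\<Sum>i=1..n+1. (norm (V i))\<^sup>2) / real n"

lemma mean_square_nonneg: "0 \<le> mean_square n V"
  unfolding mean_square_def by (intro divide_nonneg_nonneg sum_nonneg) auto

text \<open>
  Each score is at most \<open>c \<parallel>B\<^sub>i\<parallel>\<^sup>2 + 2 / n\<close> with \<open>c\<close> independent of \<open>i\<close>, and centring
  does not increase the sum of squared norms.
\<close>

lemma sum_p_score_le:
  assumes "n \<ge> 1" "lam > 0"
  shows "(\<Sum>i=1..n. p_score lam V n i)
    \<le> mean_square n V / lam + 4 * (mean_square n V)\<^sup>2 / lam\<^sup>2 + 2"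
proof -
  define S where "S = (\<Sum>i=1..n+1. (norm (V i))\<^sup>2)"
  define c where "c = 1 / (real n * lam) + 4 * S / ((real n)\<^sup>2 * lam\<^sup>2)"
  have "0 \<le> S"
    unfolding S_def by (intro sum_nonneg) simp
  then have c: "0 \<le> c"
    using assms by (simp add: c_def)
  have p: "p_score lam V n i \<le> c * (norm (Bmat V n i))\<^sup>2 + 2 / real n" if i: "i \<in> {1..n}" for i
  proof -
    have d: "0 \<le> dX lam V n"
      by (rule dX_nonneg[OF assms])
    have "ridge_hat lam n (BmatX V n) i i \<ge> 0"
      by (rule ridge_hat_nonneg[OF assms])
    moreover have "(bX lam V n i)\<^sup>2 / (1 + dX lam V n) \<le> (bX lam V n i)\<^sup>2"
      using d by (simp add: divide_le_eq mult_left_le algebra_simps)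
    moreover have "(norm (Bmat V n i))\<^sup>2 * (norm (Xc V n))\<^sup>2 / ((real n)\<^sup>2 * lam\<^sup>2)
        \<le> (norm (Bmat V n i))\<^sup>2 * (2 * S) / ((real n)\<^sup>2 * lam\<^sup>2)"
      using norm_Xc_le[OF assms(1), of V] unfolding S_def
      by (intro divide_right_mono mult_left_mono) auto
    ultimately have "p_score lam V n i \<le> (norm (Bmat V n i))\<^sup>2 / (real n * lam)
        + 2 * ((norm (Bmat V n i))\<^sup>2 * (2 * S) / ((real n)\<^sup>2 * lam\<^sup>2)) + 2 / real n"
      using ridge_hat_le[OF assms, of "Bmat V n" i] bX_sq_le[OF assms(1) _ assms(2), of i V] i
      unfolding p_score_def by auto
    then show ?thesis
      by (simp add: c_def algebra_simps)
  qed
  have "(\<Sum>i=1..n. (norm (Bmat V n i))\<^sup>2) \<le> (\<Sum>i=1..n. (norm (V i))\<^sup>2)"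
    using sum_norm_centered[OF assms(1), of V] by (simp add: Bmat_def)
  also have "\<dots> \<le> S"
    by (simp add: S_def)
  finally have B: "(\<Sum>i=1..n. (norm (Bmat V n i))\<^sup>2) \<le> S" .
  have "(\<Sum>i=1..n. p_score lam V n i) \<le> (\<Sum>i=1..n. c * (norm (Bmat V n i))\<^sup>2 + 2 / real n)"
    by (rule sum_mono) (rule p)
  also have "\<dots> = c * (\<Sum>i=1..n. (norm (Bmat V n i))\<^sup>2) + 2"
    using assms(1) by (simp add: sum.distrib sum_distrib_left)
  also have "\<dots> \<le> c * S + 2"
    using B c by (simp add: mult_left_mono)
  also have "c * S = S / real n / lam + 4 * (S / real n)\<^sup>2 / lam\<^sup>2"
    by (simp add: c_def power_divide power2_eq_square distrib_right)
  finally show ?thesis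
    by (simp only: S_def mean_square_def)
qed

lemma t_fac_le:
  assumes "n \<ge> 1" "lam > 0"
  shows "t_fac lam V n \<le> 2 * (1 + 2 * mean_square n V / lam)"
proof -
  define S where "S = (\<Sum>i=1..n+1. (norm (V i))\<^sup>2)"
  have S: "0 \<le> S"
    unfolding S_def by (intro sum_nonneg) simp
  have "Xc V n \<bullet> (matrix_inv (block11 (Sigma_hat lam V n)) *v Xc V n) \<le> (norm (Xc V n))\<^sup>2 / lam"
    using coercive_inv_bilinear_le[OF coercive_block11[OF coercive_Sigma_hat[OF assms(1)]] assms(2),
        of "Xc V n" V "Xc V n"] by (simp add: power2_eq_square)
  also have "\<dots> \<le> 2 * S / lam"
    using norm_Xc_le[OF assms(1), of V] assms(2) unfolding S_def by (intro divide_right_mono) auto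
  finally have "dX lam V n \<le> 1 / (real n + 1) * (2 * S / lam)"
    unfolding dX_def by (intro mult_left_mono) auto
  also have "\<dots> \<le> 1 / real n * (2 * S / lam)"
    using assms S by (intro mult_right_mono frac_le) auto
  finally have d: "dX lam V n \<le> 2 * (S / real n) / lam" by simp
  have "(real n + 1) / real n \<le> 2"
    using assms by (simp add: field_simps)
  then have "t_fac lam V n \<le> 2 * (1 + dX lam V n)"
    unfolding t_fac_def using dX_nonneg[OF assms, of V] by (intro mult_right_mono) auto
  moreover have "mean_square n V = S / real n"
    by (simp add: mean_square_def S_def)
  ultimately show ?thesis
    using d by simp
qed

text \<open>
  The product of the bound for \<open>t_fac\<close> and the bound for \<open>q_quant\<close>, as functions of \<open>mean_square\<close>.
\<close>

definition threshold_bound :: "real \<Rightarrow> real \<Rightarrow> real \<Rightarrow> real" where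
  "threshold_bound lam \<alpha> s = 2 * (1 + 2 * s / lam) * (2 / \<alpha> * (s / lam + 4 * s\<^sup>2 / lam\<^sup>2 + 2))"

lemma threshold_bound_mono:
  assumes "0 \<le> s" "s \<le> s'" "lam > 0" "\<alpha> > 0"
  shows "threshold_bound lam \<alpha> s \<le> threshold_bound lam \<alpha> s'"
  unfolding threshold_bound_def
  by (intro mult_mono add_mono divide_right_mono power_mono order_refl)
    (use assms in \<open>auto intro!: add_nonneg_nonneg mult_nonneg_nonneg\<close>)

lemma t_fac_q_quant_le:
  assumes "\<alpha> > 0" "\<alpha> < 1" "real n \<ge> 2 / \<alpha>" "n \<ge> 1" "lam > 0"
  shows "t_fac lam V n * q_quant lam V n \<alpha> \<le> threshold_bound lam \<alpha> (mean_square n V)"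
proof -
  have "2 / \<alpha> * (\<Sum>i=1..n. p_score lam V n i)
      \<le> 2 / \<alpha> * (mean_square n V / lam + 4 * (mean_square n V)\<^sup>2 / lam\<^sup>2 + 2)"
    using assms by (intro mult_left_mono sum_p_score_le) auto
  then have q: "q_quant lam V n \<alpha>
      \<le> 2 / \<alpha> * (mean_square n V / lam + 4 * (mean_square n V)\<^sup>2 / lam\<^sup>2 + 2)"
    using q_quant_le_sum[OF assms(1-3,5), of V] by linarith
  have "2 \<le> \<alpha> * real n"
    using assms by (simp add: field_simps)
  then have "1 / (real n + 1) < \<alpha>"
    using assms(1) by (simp add: field_simps)
  then have q0: "0 \<le> q_quant lam V n \<alpha>"
    by (rule q_quant_nonneg) (use assms in auto)
  have "0 \<le> 2 * (1 + 2 * mean_square n V / lam)"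
    using assms mean_square_nonneg[of n V] by simp
  then show ?thesis
    unfolding threshold_bound_def
    by (intro mult_mono t_fac_le q q0 assms)
qed

section \<open>The prediction set\<close>

text \<open>
  An ellipsoid is not the whole space: the inverse Schur complement is positive definite, so its
  quadratic form exceeds \<open>rho\<close> far from the centre.
\<close>

lemma F_set_eq_UNIV_iff:
  fixes V :: "nat \<Rightarrow> real^('k::finite + 'l::finite)"
  assumes "n \<ge> 1" "lam > 0"
  shows "F_set lam V n \<alpha> = UNIV \<longleftrightarrow> t_fac lam V n * q_quant lam V n \<alpha> \<ge> real n"
proof
  assume F: "F_set lam V n \<alpha> = UNIV"
  show "t_fac lam V n * q_quant lam V n \<alpha> \<ge> real n"
  proof (rule ccontr)
    assume "\<not> ?thesis"
    with F have le: "(z - Z0 lam V n) \<bullet> (matrix_inv (A_mat lam V n) *v (z - Z0 lam V n))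
        \<le> rho lam V n \<alpha>" for z
      by (auto simp: F_set_def split: if_splits)
    define u :: "real^'l" where "u = 1"
    have "u \<noteq> 0"
      by (simp add: u_def)
    define e where "e = u \<bullet> (matrix_inv (A_mat lam V n) *v u)"
    have "e > 0"
      unfolding e_def A_mat_def Let_def
      by (rule coercive_inv_pos[OF coercive_Schur_complement[OF coercive_Sigma_hat]])
        (use assms \<open>u \<noteq> 0\<close> in auto)
    \<comment> \<open>At \<open>Z0 + c u\<close> the quadratic form has the value \<open>\<bar>rho\<bar> + 1\<close>.\<close>
    define c where "c = sqrt ((\<bar>rho lam V n \<alpha>\<bar> + 1) / e)"
    have "c\<^sup>2 * e = \<bar>rho lam V n \<alpha>\<bar> + 1"
      using \<open>e > 0\<close> by (simp add: c_def)
    moreover have "c\<^sup>2 * e \<le> rho lam V n \<alpha>"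
      using le[of "Z0 lam V n + c *\<^sub>R u"]
      by (simp add: e_def power2_eq_square matrix_vector_mult_scaleR)
    ultimately show False by linarith
  qed
qed (simp add: F_set_def)

lemma Z0_in_F_set:
  assumes "t_fac lam V n * q_quant lam V n \<alpha> < real n \<Longrightarrow> 0 \<le> rho lam V n \<alpha>"
  shows "Z0 lam V n \<in> F_set lam V n \<alpha>"
  using assms by (auto simp: F_set_def)

text \<open>
  Markov's inequality; the factor \<open>2\<close> bounds \<open>(n + 1) / n\<close>.
\<close>

lemma (in prob_space) prob_mean_square_ge_le:
  fixes V :: "nat \<Rightarrow> 'a \<Rightarrow> real^'c"
  assumes meas: "\<And>i. i \<ge> 1 \<Longrightarrow> V i \<in> borel_measurable M"
    and ident: "\<And>i. i \<ge> 1 \<Longrightarrow> distr M borel (V i) = distr M borel (V 1)"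
    and int: "integrable M (\<lambda>\<omega>. (norm (V 1 \<omega>))\<^sup>2)"
    and "n \<ge> 1" "K > 0"
  shows "prob {\<omega> \<in> space M. K \<le> mean_square n (\<lambda>i. V i \<omega>)}
    \<le> 2 * expectation (\<lambda>\<omega>. (norm (V 1 \<omega>))\<^sup>2) / K"
proof -
  let ?E = "expectation (\<lambda>\<omega>. (norm (V 1 \<omega>))\<^sup>2)"
  have sq: "(\<lambda>x::real^'c. (norm x)\<^sup>2) \<in> borel_measurable borel"
    by measurable
  have inti: "integrable M (\<lambda>\<omega>. (norm (V i \<omega>))\<^sup>2)" if "i \<ge> 1" for i
    using int integrable_distr_eq[OF meas[OF that] sq] integrable_distr_eq[OF meas[of 1] sq]
      ident[OF that] by simp
  have expi: "expectation (\<lambda>\<omega>. (norm (V i \<omega>))\<^sup>2) = ?E" if "i \<ge> 1" for i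
    using integral_distr[OF meas[OF that] sq] integral_distr[OF meas[of 1] sq]
      ident[OF that] by simp
  have "prob {\<omega> \<in> space M. K \<le> mean_square n (\<lambda>i. V i \<omega>)}
      \<le> expectation (\<lambda>\<omega>. mean_square n (\<lambda>i. V i \<omega>)) / K"
  proof (rule integral_Markov_inequality_measure[where A = "{}"])
    show "integrable M (\<lambda>\<omega>. mean_square n (\<lambda>i. V i \<omega>))"
      unfolding mean_square_def by (intro integrable_divide Bochner_Integration.integrable_sum inti) auto
    show "AE \<omega> in M. 0 \<le> mean_square n (\<lambda>i. V i \<omega>)"
      by (intro AE_I2 mean_square_nonneg)
  qed (use assms in auto)
  also have "expectation (\<lambda>\<omega>. mean_square n (\<lambda>i. V i \<omega>)) = (real n + 1) / real n * ?E"
  proof -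
    have "expectation (\<lambda>\<omega>. \<Sum>i=1..n+1. (norm (V i \<omega>))\<^sup>2)
        = (\<Sum>i=1..n+1. expectation (\<lambda>\<omega>. (norm (V i \<omega>))\<^sup>2))"
      by (intro Bochner_Integration.integral_sum inti) auto
    also have "\<dots> = (\<Sum>i=1..n+1. ?E)"
      by (intro sum.cong expi) auto
    also have "\<dots> = (real n + 1) * ?E"
      by simp
    finally show ?thesis
      by (simp only: mean_square_def integral_divide_zero) simp
  qed
  also have "(real n + 1) / real n * ?E / K \<le> 2 * ?E / K"
    using assms by (intro divide_right_mono mult_right_mono) (auto simp: field_simps)
  finally show ?thesis .
qed

text \<open>
  Choose \<open>K\<close> with \<open>P(s \<ge> K) < r\<close> for all \<open>n\<close>, where \<open>s\<close> is \<open>mean_square\<close>. As soon as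
  \<open>n\<close> exceeds the bound for \<open>t_fac * q_quant\<close> at \<open>s = K\<close>, the prediction set can be the whole
  space only if \<open>s \<ge> K\<close>.
\<close>

lemma (in prob_space) prob_F_set_UNIV_tendsto_0:
  fixes V :: "nat \<Rightarrow> 'a \<Rightarrow> real^('k::finite + 'l::finite)"
  assumes meas: "\<And>i. i \<ge> 1 \<Longrightarrow> V i \<in> borel_measurable M"
    and ident: "\<And>i. i \<ge> 1 \<Longrightarrow> distr M borel (V i) = distr M borel (V 1)"
    and int: "integrable M (\<lambda>\<omega>. (norm (V 1 \<omega>))\<^sup>2)"
    and "0 < \<alpha>" "\<alpha> < 1" "lam > 0"
  shows "(\<lambda>n. prob {\<omega> \<in> space M. F_set lam (\<lambda>i. V i \<omega>) n \<alpha> = UNIV}) \<longlonglongrightarrow> 0"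
proof (rule LIMSEQ_I)
  fix r :: real
  assume r: "r > 0"
  let ?E = "expectation (\<lambda>\<omega>. (norm (V 1 \<omega>))\<^sup>2)"
  have E: "?E \<ge> 0" by (intro Bochner_Integration.integral_nonneg) auto
  \<comment> \<open>Markov's inequality at level \<open>K\<close> gives \<open>2 ?E / K\<close>, which is below \<open>r\<close>; the \<open>1\<close> covers \<open>?E = 0\<close>.\<close>
  define K where "K = (2 * ?E + 1) / r"
  have "K > 0"
    unfolding K_def using E r by (intro divide_pos_pos) linarith+
  moreover have "K * r = 2 * ?E + 1"
    using r by (simp add: K_def)
  ultimately have K: "K > 0" "2 * ?E / K < r"
    by (simp_all add: pos_divide_less_eq mult.commute)
  obtain N where N: "real N > max (max (2 / \<alpha>) (threshold_bound lam \<alpha> K)) 1"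
    using reals_Archimedean2 by blast
  have "prob {\<omega> \<in> space M. F_set lam (\<lambda>i. V i \<omega>) n \<alpha> = UNIV} < r" (is "prob ?F < r")
    if "n \<ge> N" for n
  proof -
    have n: "real n \<ge> 2 / \<alpha>" "threshold_bound lam \<alpha> K < real n" "n \<ge> 1"
      using N that by auto
    let ?G = "{\<omega> \<in> space M. K \<le> mean_square n (\<lambda>i. V i \<omega>)}"
    have "?F \<subseteq> ?G"
    proof safe
      fix \<omega>
      assume "F_set lam (\<lambda>i. V i \<omega>) n \<alpha> = UNIV"
      then have "real n \<le> threshold_bound lam \<alpha> (mean_square n (\<lambda>i. V i \<omega>))"
        using t_fac_q_quant_le[OF assms(4,5) n(1,3) assms(6), of "\<lambda>i. V i \<omega>"]
        by (simp add: F_set_eq_UNIV_iff[OF n(3) assms(6)])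
      then show "K \<le> mean_square n (\<lambda>i. V i \<omega>)"
        using threshold_bound_mono[of "mean_square n (\<lambda>i. V i \<omega>)" K lam \<alpha>] n(2) assms(4,6)
          mean_square_nonneg[of n "\<lambda>i. V i \<omega>"]
        by linarith
    qed
    moreover have "?G \<in> events"
    proof -
      have "(\<lambda>\<omega>. mean_square n (\<lambda>i. V i \<omega>)) \<in> borel_measurable M"
        unfolding mean_square_def using meas by (intro borel_measurable_divide borel_measurable_sum borel_measurable_power
            borel_measurable_norm) auto
      then show ?thesis by measurable
    qed
    ultimately have "prob ?F \<le> prob ?G"
      by (rule finite_measure_mono)
    also have "\<dots> \<le> 2 * ?E / K"
      by (intro prob_mean_square_ge_le[where V = V] meas ident int n(3) K(1))
    finally show ?thesis
      using K(2) by linarith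
  qed
  then show "\<exists>N. \<forall>n\<ge>N. norm (prob {\<omega> \<in> space M. F_set lam (\<lambda>i. V i \<omega>) n \<alpha> = UNIV} - 0) < r"
    by auto
qed

theorem proposition3p7:
  fixes M :: "'a measure"
    and X :: "nat \<Rightarrow> 'a \<Rightarrow> real^'k"
    and Y :: "nat \<Rightarrow> 'a \<Rightarrow> real^'l"
    and f :: "real^'k \<Rightarrow> real^'l"
    and lam :: real
    and V :: "nat \<Rightarrow> 'a \<Rightarrow> real^('k::finite + 'l::finite)"
  assumes "prob_space M"
    and "lam > 0"
    and "f \<in> borel_measurable borel"
    and V_def: "\<And>i \<omega>. V i \<omega> = stack (X i \<omega>) (Y i \<omega> - f (X i \<omega>))"
  shows
    "(\<forall>(n::nat) \<alpha>::real.
        1 / (real n + 1) < \<alpha> \<longrightarrow> \<alpha> < 1 \<longrightarrow>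
        (\<forall>i\<in>{1..n+1}. X i \<in> borel_measurable M \<and> Y i \<in> borel_measurable M) \<longrightarrow>
        exchangeable M borel {1..n+1} (\<lambda>i \<omega>. (X i \<omega>, Y i \<omega>)) \<longrightarrow>
        (\<forall>\<omega>\<in>space M.
           (t_fac lam (\<lambda>i. V i \<omega>) n * q_quant lam (\<lambda>i. V i \<omega>) n \<alpha> < real n \<longrightarrow>
              rho lam (\<lambda>i. V i \<omega>) n \<alpha> \<ge> 0) \<and>
           Z0 lam (\<lambda>i. V i \<omega>) n \<in> F_set lam (\<lambda>i. V i \<omega>) n \<alpha> \<and>
           F_set lam (\<lambda>i. V i \<omega>) n \<alpha> \<noteq> {}))
   \<and> (\<forall>\<alpha>::real.
        0 < \<alpha> \<longrightarrow> \<alpha> < 1 \<longrightarrow>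
        (\<forall>i\<ge>1. X i \<in> borel_measurable M \<and> Y i \<in> borel_measurable M) \<longrightarrow>
        prob_space.indep_vars M (\<lambda>_. borel) V {1..} \<longrightarrow>
        (\<forall>i\<ge>1. distr M borel (V i) = distr M borel (V 1)) \<longrightarrow>
        integrable M (\<lambda>\<omega>. (norm (V 1 \<omega>))\<^sup>2) \<longrightarrow>
        (\<exists>U. open U \<and> 1 - \<alpha> \<in> U \<and>
           continuous_on U
             (quantile_fun M
               (\<lambda>\<omega>. (norm (matrix_inv (psd_sqrt (covariance_matrix M (V 1) + lam *\<^sub>R mat 1))
                            *v (V 1 \<omega> - (LINT \<xi>|M. V 1 \<xi>))))\<^sup>2))) \<longrightarrow>
        (\<lambda>n. measure M {\<omega> \<in> space M. F_set lam (\<lambda>i. V i \<omega>) n \<alpha> = UNIV}) \<longlonglongrightarrow> 0)"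
proof -
  interpret prob_space M by fact
  show ?thesis
  proof (intro conjI allI impI ballI)
    fix n :: nat and \<alpha> :: real and \<omega> :: 'a
    assume \<alpha>: "1 / (real n + 1) < \<alpha>" "\<alpha> < 1"
    then have n: "n \<ge> 1"
      by (cases n) auto
    let ?V = "\<lambda>i. V i \<omega>"
    have rho: "0 \<le> rho lam ?V n \<alpha>" if "t_fac lam ?V n * q_quant lam ?V n \<alpha> < real n"
      by (rule rho_nonneg[OF q_quant_nonneg[OF \<alpha> n \<open>lam > 0\<close>] that])
    then show "t_fac lam ?V n * q_quant lam ?V n \<alpha> < real n \<Longrightarrow> 0 \<le> rho lam ?V n \<alpha>" .
    show "Z0 lam ?V n \<in> F_set lam ?V n \<alpha>"
      by (rule Z0_in_F_set) (rule rho)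
    then show "F_set lam ?V n \<alpha> \<noteq> {}"
      by blast
  next
    fix \<alpha> :: real
    assume \<alpha>: "0 < \<alpha>" "\<alpha> < 1"
      and indep: "indep_vars (\<lambda>_. borel) V {1..}"
      and ident: "\<forall>i\<ge>1. distr M borel (V i) = distr M borel (V 1)"
      and int: "integrable M (\<lambda>\<omega>. (norm (V 1 \<omega>))\<^sup>2)"
    have meas: "V i \<in> borel_measurable M" if "i \<ge> 1" for i
      using indep that by (auto simp: indep_vars_def)
    show "(\<lambda>n. prob {\<omega> \<in> space M. F_set lam (\<lambda>i. V i \<omega>) n \<alpha> = UNIV}) \<longlonglongrightarrow> 0"
      by (intro prob_F_set_UNIV_tendsto_0[where V = V] meas ident[rule_format] int \<alpha> \<open>lam > 0\<close>)
  qed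
qed

end
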